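(* For each $i\in\{1,2\}$ let $C_i$ be a nonempty, closed and convex subset of a $2$-uniformly convex smooth Banach space $E_i$ with constant of smoothness $c_i$. Let $F:C_1\to E_1$ be $\alpha_1$-strongly monotone and $\beta_1$-Lipschitz continuous; let $G:C_1\to E_1$ be $\alpha_2$-strongly monotone and $\beta_2$-Lipschitz continuous; let $f:C_2\to E_2$ be $\sigma_1$-strongly monotone and $\eta_1$-Lipschitz continuous; and let $g:C_2\to E_2$ be $\sigma_2$-strongly monotone and $\eta_2$-Lipschitz continuous. Let $A:E_1\to E_2$ be a bounded linear operator with generalized adjoint $A^+$. Let $\gamma,\rho>0$ and let $\lambda>0$ satisfy $$\max_{1\le i\le 2}\left\{\frac{\alpha_i-\sqrt{\alpha_i^2-c_1\beta_i^2(1-p_i^2)}}{c_1\beta_i^2}\right\}<\lambda<\min_{1\le i\le 2}\left\{\frac{\alpha_i+\sqrt{\alpha_i^2-c_1\beta_i^2(1-p_i^2)}}{c_1\beta_i^2}\right\},$$ where, for $i=1,2$, $$\alpha_i>\beta_i\sqrt{c_1(1-p_i^2)},\qquad p_i=\frac{1-m\theta_{i+2}}{1+m},\qquad m=\rho\|A^+\|\|A\|,\qquad \theta_{i+2}=\sqrt{1-2\gamma\sigma_i+c_2\gamma^2\eta_i^2}.$$ Suppose $(x_1,y_1)\in C_1\times C_1$ is a solution of the system of split variational inequality problems (SSpVIP) with data $(F,G,f,g,A,\lambda,\gamma)$. Then the sequence $\{(x_1^n,y_1^n)\}$ generated by the Iterative Algorithm defined in the context (with parameters $\lambda,\gamma,\rho$)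 converges strongly to $(x_1,y_1)$.
   Context: All spaces are real. For a smooth Banach space $E$ with dual $E^*$, the normalized duality mapping $J:E\to E^*$ is the single-valued map determined by $\langle x,J(x)\rangle=\|x\|^2$ and $\|J(x)\|=\|x\|$. The semi-inner product on $E$ is $[y,x]=\langle y,J(x)\rangle$; it is linear in the first argument and $[x,x]=\|x\|^2$. Constant of smoothness: saying that $E_i$ has constant of smoothness $c_i$ means that $E_i$ satisfies $\|x+y\|^2\le\|x\|^2+2[y,x]+c_i\|y\|^2$ for all $x,y\in E_i$, with $c_i>0$ chosen as the best possible minimum value. Generalized adjoint: for a bounded linear $A:E_1\to E_2$, $A^+:E_2\to E_1$ is the (not necessarily linear) operator determined by $[Ax,y]_{E_2}=[x,A^+y]_{E_1}$ for all $x\in E_1$, $y\in E_2$. It is defined on all of $E_2$ and bounded, with $\|A^+y\|\le\|A\|\|y\|$; $\|A^+\|$ denotes the least constant $M\ge 0$ with $\|A^+y\|\le M\|y\|$ for all $y\in E_2$. A map $T:C\to E$ on a subset $C\subset E$ is $\alpha$-strongly monotone ($\alpha>0$) if $[Tx-Ty,x-y]\ge\alpha\|x-y\|^2$ for all $x,y\in C$, and $\beta$-Lipschitz continuous ($\beta>0$) if $\|Tx-Ty\|\le\beta\|x-y\|$ for all $x,y\in C$. $Q_{C_i}:E_i\to C_i$ denotes a sunny nonexpansive retraction of $E_i$ onto $C_i$. Equivalently, it is a retraction onto $C_i$ with $[x-Q_{C_i}x,\,y-Q_{C_i}x]\le 0$ for all $x\in E_i$, $y\in C_i$. Sunny means $Q_{C_i}(Q_{C_i}x+t(x-Q_{C_i}x))=Q_{C_i}x$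 for all $x\in E_i$, $t\ge 0$. SSpVIP: $(x_1,y_1)\in C_1\times C_1$ is a solution if, with $x_2=Ax_1\in C_2$ and $y_2=Ay_1\in C_2$, $$[\lambda Fy_1+x_1-y_1,\,z_1-x_1]\ge 0\ \ \forall z_1\in C_1,\qquad [\gamma fy_2+x_2-y_2,\,z_2-x_2]\ge 0\ \ \forall z_2\in C_2,$$ $$[\lambda Gx_1+y_1-x_1,\,z_1-y_1]\ge 0\ \ \forall z_1\in C_1,\qquad [\gamma gx_2+y_2-x_2,\,z_2-y_2]\ge 0\ \ \forall z_2\in C_2.$$ Iterative Algorithm: let $\{\alpha^n\}\subseteq(0,1)$ be a sequence with $\sum_{n=1}^\infty\alpha^n=\infty$ (here $n$ is an index, not a power). Given $(x_1^0,y_1^0)\in C_1\times C_1$, for $n=0,1,2,\dots$ set $x_2^n=Ax_1^n$, $y_2^n=Ay_1^n$ and $$a_1^n=Q_{C_1}(y_1^n-\lambda Fy_1^n),\quad a_2^n=Q_{C_2}(y_2^n-\gamma fy_2^n),\quad b_1^n=Q_{C_1}(x_1^n-\lambda Gx_1^n),\quad b_2^n=Q_{C_2}(x_2^n-\gamma gx_2^n),$$ $$x_1^{n+1}=(1-\alpha^n)x_1^n+\alpha^n\big(a_1^n+\rho A^+(a_2^n-Aa_1^n)\big),\qquad y_1^{n+1}=(1-\alpha^n)y_1^n+\alpha^n\big(b_1^n+\rho A^+(b_2^n-Ab_1^n)\big).$$ It is understood that the sequence is generated, i.e. that $x_1^n,y_1^n\in C_1$ and $x_2^n,y_2^n\in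 C_2$ for all $n$, so that all the expressions are defined.
   Formalization: Adds the hypothesis p_i ≥ 0 (i.e. mθ_{i+2} ≤ 1) for i=1,2, without which the claim fails (all maps the identity on ℝ, ρ=λ=1, γ=3), and makes explicit that 1−2γσ_i+c_2γ²η_i² ≥ 0, so that θ_{i+2} is real. *)

theory Defs
  imports "HOL-Analysis.Analysis"
begin

text \<open>Geometry of the space. Properties of a whole space are predicates on its type.\<close>

definition smooth_space :: "'a::real_normed_vector itself \<Rightarrow> bool" where
  "smooth_space _ \<longleftrightarrow>
     (\<forall>x::'a. x \<noteq> 0 \<longrightarrow> (\<exists>!\<phi>::'a \<Rightarrow>\<^sub>L real. norm \<phi> = 1 \<and> blinfun_apply \<phi> x = norm x))"

text \<open>For \<open>0 < \<epsilon> \<le> 2\<close> and a nonzero space, the set below is nonempty and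
  bounded below by 0, so the infimum is the genuine one.\<close>

definition modulus_of_convexity :: "'a::real_normed_vector itself \<Rightarrow> real \<Rightarrow> real" where
  "modulus_of_convexity _ \<epsilon> =
     Inf {1 - norm ((1/2) *\<^sub>R (x + y)) | x y :: 'a. norm x = 1 \<and> norm y = 1 \<and> norm (x - y) \<ge> \<epsilon>}"

definition two_uniformly_convex :: "'a::real_normed_vector itself \<Rightarrow> bool" where
  "two_uniformly_convex T \<longleftrightarrow>
     (\<exists>K>0. \<forall>\<epsilon>. 0 < \<epsilon> \<and> \<epsilon> \<le> 2 \<longrightarrow> modulus_of_convexity T \<epsilon> \<ge> K * \<epsilon>\<^sup>2)"

definition duality_map :: "'a::real_normed_vector \<Rightarrow> ('a \<Rightarrow>\<^sub>L real)" where
  "duality_map x = (THE j. blinfun_apply j x = (norm x)\<^sup>2 \<and> norm j = norm x)"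

text \<open>The semi-inner product \<open>[y, x]\<close>, linear in its first argument.\<close>

definition sip :: "'a::real_normed_vector \<Rightarrow> 'a \<Rightarrow> real" where
  "sip y x = blinfun_apply (duality_map x) y"

definition smoothness_bound :: "'a::real_normed_vector itself \<Rightarrow> real \<Rightarrow> bool" where
  "smoothness_bound _ c \<longleftrightarrow>
     (\<forall>x y::'a. (norm (x + y))\<^sup>2 \<le> (norm x)\<^sup>2 + 2 * sip y x + c * (norm y)\<^sup>2)"

definition constant_of_smoothness :: "'a::real_normed_vector itself \<Rightarrow> real \<Rightarrow> bool" where
  "constant_of_smoothness T c \<longleftrightarrow>
     c > 0 \<and> smoothness_bound T c \<and> (\<forall>c'>0. smoothness_bound T c' \<longrightarrow> c \<le> c')"

definition gen_adjoint ::
  "('a::real_normed_vector \<Rightarrow>\<^sub>L 'b::real_normed_vector) \<Rightarrow> 'b \<Rightarrow> 'a" where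
  "gen_adjoint A = (THE B. \<forall>x y. sip (blinfun_apply A x) y = sip x (B y))"

text \<open>The norm of a bounded, possibly nonlinear operator such as the generalized adjoint.\<close>

definition opnorm :: "('b::real_normed_vector \<Rightarrow> 'a::real_normed_vector) \<Rightarrow> real" where
  "opnorm T = (LEAST M. 0 \<le> M \<and> (\<forall>y. norm (T y) \<le> M * norm y))"

definition strongly_monotone_on ::
  "'a::real_normed_vector set \<Rightarrow> real \<Rightarrow> ('a \<Rightarrow> 'a) \<Rightarrow> bool" where
  "strongly_monotone_on C \<alpha> T \<longleftrightarrow>
     \<alpha> > 0 \<and> (\<forall>x\<in>C. \<forall>y\<in>C. sip (T x - T y) (x - y) \<ge> \<alpha> * (norm (x - y))\<^sup>2)"

definition lipschitz_continuous_on ::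
  "'a::real_normed_vector set \<Rightarrow> real \<Rightarrow> ('a \<Rightarrow> 'a) \<Rightarrow> bool" where
  "lipschitz_continuous_on C \<beta> T \<longleftrightarrow>
     \<beta> > 0 \<and> (\<forall>x\<in>C. \<forall>y\<in>C. norm (T x - T y) \<le> \<beta> * norm (x - y))"

definition sunny_nonexpansive_retraction ::
  "'a::real_normed_vector set \<Rightarrow> ('a \<Rightarrow> 'a) \<Rightarrow> bool" where
  "sunny_nonexpansive_retraction C Q \<longleftrightarrow>
     (\<forall>x. Q x \<in> C) \<and> (\<forall>x\<in>C. Q x = x) \<and>
     (\<forall>x y. norm (Q x - Q y) \<le> norm (x - y)) \<and>
     (\<forall>x. \<forall>t\<ge>0. Q (Q x + t *\<^sub>R (x - Q x)) = Q x)"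

definition SSpVIP_solution ::
  "'a::real_normed_vector set \<Rightarrow> 'b::real_normed_vector set \<Rightarrow>
   ('a \<Rightarrow> 'a) \<Rightarrow> ('a \<Rightarrow> 'a) \<Rightarrow> ('b \<Rightarrow> 'b) \<Rightarrow> ('b \<Rightarrow> 'b) \<Rightarrow>
   ('a \<Rightarrow>\<^sub>L 'b) \<Rightarrow> real \<Rightarrow> real \<Rightarrow> 'a \<Rightarrow> 'a \<Rightarrow> bool" where
  "SSpVIP_solution C1 C2 F G f g A lam gam x1 y1 \<longleftrightarrow>
     x1 \<in> C1 \<and> y1 \<in> C1 \<and>
     (let x2 = blinfun_apply A x1; y2 = blinfun_apply A y1 in
        x2 \<in> C2 \<and> y2 \<in> C2 \<and>
        (\<forall>z1\<in>C1. sip (lam *\<^sub>R F y1 + x1 - y1) (z1 - x1) \<ge> 0) \<and>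
        (\<forall>z2\<in>C2. sip (gam *\<^sub>R f y2 + x2 - y2) (z2 - x2) \<ge> 0) \<and>
        (\<forall>z1\<in>C1. sip (lam *\<^sub>R G x1 + y1 - x1) (z1 - y1) \<ge> 0) \<and>
        (\<forall>z2\<in>C2. sip (gam *\<^sub>R g x2 + y2 - x2) (z2 - y2) \<ge> 0))"

text \<open>\<open>x\<close> and \<open>y\<close> are the sequences of iterates in the first space, \<open>a\<close> the step sizes.
  The maps \<open>F, G, f, g\<close> are meaningful only on \<open>C1\<close> and \<open>C2\<close>, so membership of all the
  iterates (and of their images under \<open>A\<close>) is part of the sequence being generated.\<close>

definition generated_by_algorithm ::
  "'a::real_normed_vector set \<Rightarrow> 'b::real_normed_vector set \<Rightarrow> ('a \<Rightarrow> 'a) \<Rightarrow> ('b \<Rightarrow> 'b) \<Rightarrow>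
   ('a \<Rightarrow> 'a) \<Rightarrow> ('a \<Rightarrow> 'a) \<Rightarrow> ('b \<Rightarrow> 'b) \<Rightarrow> ('b \<Rightarrow> 'b) \<Rightarrow>
   ('a \<Rightarrow>\<^sub>L 'b) \<Rightarrow> real \<Rightarrow> real \<Rightarrow> real \<Rightarrow>
   (nat \<Rightarrow> real) \<Rightarrow> (nat \<Rightarrow> 'a) \<Rightarrow> (nat \<Rightarrow> 'a) \<Rightarrow> bool" where
  "generated_by_algorithm C1 C2 Q1 Q2 F G f g A lam gam rho a x y \<longleftrightarrow>
     (\<forall>n. let x2 = blinfun_apply A (x n); y2 = blinfun_apply A (y n);
              a1 = Q1 (y n - lam *\<^sub>R F (y n)); a2 = Q2 (y2 - gam *\<^sub>R f y2);
              b1 = Q1 (x n - lam *\<^sub>R G (x n)); b2 = Q2 (x2 - gam *\<^sub>R g x2)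
          in x n \<in> C1 \<and> y n \<in> C1 \<and> x2 \<in> C2 \<and> y2 \<in> C2 \<and>
             x (Suc n) = (1 - a n) *\<^sub>R x n
               + a n *\<^sub>R (a1 + rho *\<^sub>R gen_adjoint A (a2 - blinfun_apply A a1)) \<and>
             y (Suc n) = (1 - a n) *\<^sub>R y n
               + a n *\<^sub>R (b1 + rho *\<^sub>R gen_adjoint A (b2 - blinfun_apply A b1)))"

end

theory Submission
  imports Defs
begin

text \<open>
  Solutions of the split system are fixed points of the iteration: by the variational
  characterization of sunny nonexpansive retractions, each inequality says that a retraction
  applied to a forward step returns the solution. The smoothness inequality makes the forward
  steps Lipschitz, with squared constant \<open>1 - 2 \<lambda> \<alpha> + c \<lambda>\<^sup>2 \<beta>\<^sup>2\<close>, and the interval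
  prescribed for \<open>\<lambda>\<close> is exactly where this is below \<open>p\<^sup>2\<close>; so the sum of the two errors
  contracts by a factor \<open>1 - \<alpha>\<^sup>n (1 - k)\<close> in each step, and \<open>\<Sum> \<alpha>\<^sup>n = \<infinity>\<close> drives it to 0.
  The generalized adjoint has to be shown to exist: by 2-uniform convexity, functionals attain
  their norm at exactly one unit vector, so the duality map is a bijection and
  \<open>A\<^sup>+ = J\<^sup>-\<^sup>1 \<circ> A\<^sup>* \<circ> J\<close>.
\<close>

section \<open>The duality map of a smooth space\<close>

text \<open>Smoothness supplies the unique norm-one functional norming \<open>x\<close>, and the
  duality condition rescales it by \<open>norm x\<close>; at 0 the norm condition leaves only
  \<open>j = 0\<close>. This gives \<open>THE\<close> in \<open>duality_map\<close> its
  meaning.\<close>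

lemma duality_map_ex1:
  fixes x :: "'a::real_normed_vector"
  assumes "smooth_space TYPE('a)"
  shows "\<exists>!j::'a \<Rightarrow>\<^sub>L real. blinfun_apply j x = (norm x)\<^sup>2 \<and> norm j = norm x"
proof (cases "x = 0")
  case True
  then show ?thesis by (auto simp: blinfun.zero_right)
next
  case False
  then obtain \<phi> :: "'a \<Rightarrow>\<^sub>L real" where \<phi>: "norm \<phi> = 1" "blinfun_apply \<phi> x = norm x"
    and uniq: "\<And>\<psi>::'a \<Rightarrow>\<^sub>L real. norm \<psi> = 1 \<Longrightarrow> blinfun_apply \<psi> x = norm x \<Longrightarrow> \<psi> = \<phi>"
    using assms unfolding smooth_space_def by metis
  show ?thesis
  proof (rule ex1I[of _ "norm x *\<^sub>R \<phi>"])
    show "blinfun_apply (norm x *\<^sub>R \<phi>) x = (norm x)\<^sup>2 \<and> norm (norm x *\<^sub>R \<phi>) = norm x"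
      using \<phi> by (simp add: blinfun.scaleR_left power2_eq_square)
  next
    fix j :: "'a \<Rightarrow>\<^sub>L real"
    assume j: "blinfun_apply j x = (norm x)\<^sup>2 \<and> norm j = norm x"
    have "(1 / norm x) *\<^sub>R j = \<phi>"
      using j False by (intro uniq) (auto simp: blinfun.scaleR_left power2_eq_square)
    then have "norm x *\<^sub>R ((1 / norm x) *\<^sub>R j) = norm x *\<^sub>R \<phi>" by simp
    then show "j = norm x *\<^sub>R \<phi>" using False by simp
  qed
qed

lemma
  fixes x :: "'a::real_normed_vector"
  assumes "smooth_space TYPE('a)"
  shows duality_map_self: "blinfun_apply (duality_map x) x = (norm x)\<^sup>2"
    and norm_duality_map: "norm (duality_map x) = norm x"
  using theI'[OF duality_map_ex1[OF assms, of x]] by (simp_all add: duality_map_def)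

lemma duality_map_eqI:
  fixes x :: "'a::real_normed_vector"
  assumes "smooth_space TYPE('a)" "blinfun_apply j x = (norm x)\<^sup>2" "norm j = norm x"
  shows "duality_map x = j"
  unfolding duality_map_def
  using assms by (intro the1_equality[OF duality_map_ex1]) auto

lemma duality_map_minus:
  fixes x :: "'a::real_normed_vector"
  assumes "smooth_space TYPE('a)"
  shows "duality_map (- x) = - duality_map x"
  by (rule duality_map_eqI[OF assms])
    (simp_all add: blinfun.minus_left blinfun.minus_right duality_map_self[OF assms]
      norm_duality_map[OF assms])

lemma
  fixes x y :: "'a::real_normed_vector"
  assumes "smooth_space TYPE('a)"
  shows sip_self: "sip x x = (norm x)\<^sup>2"
    and sip_minus_right: "sip y (- x) = - sip y x"
  by (simp_all add: sip_def duality_map_self[OF assms] duality_map_minus[OF assms]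
      blinfun.minus_left)

lemma
  fixes x y z :: "'a::real_normed_vector"
  shows sip_add_left: "sip (y + z) x = sip y x + sip z x"
    and sip_diff_left: "sip (y - z) x = sip y x - sip z x"
    and sip_minus_left: "sip (- y) x = - sip y x"
    and sip_scaleR_left: "sip (t *\<^sub>R y) x = t * sip y x"
  by (simp_all add: sip_def blinfun.add_right blinfun.diff_right blinfun.minus_right
      blinfun.scaleR_right)

section \<open>Two-uniform convexity and the generalized adjoint\<close>

text \<open>The modulus is an infimum over pairs at distance at least \<epsilon>, and
  \<open>x\<close>, \<open>y\<close> is such a pair for \<epsilon> = \<open>norm (x - y)\<close>,
  which is at most 2. Equal vectors are treated apart since \<epsilon> must be positive.\<close>

lemma two_uniformly_convexD:
  assumes "two_uniformly_convex TYPE('a::real_normed_vector)"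
  obtains K where "K > 0"
    "\<And>x y::'a. norm x = 1 \<Longrightarrow> norm y = 1 \<Longrightarrow>
       norm ((1/2) *\<^sub>R (x + y)) \<le> 1 - K * (norm (x - y))\<^sup>2"
proof -
  obtain K where K: "K > 0"
    "\<And>\<epsilon>. 0 < \<epsilon> \<Longrightarrow> \<epsilon> \<le> 2 \<Longrightarrow> modulus_of_convexity TYPE('a) \<epsilon> \<ge> K * \<epsilon>\<^sup>2"
    using assms unfolding two_uniformly_convex_def by blast
  have "norm ((1/2) *\<^sub>R (x + y)) \<le> 1 - K * (norm (x - y))\<^sup>2"
    if xy: "norm x = 1" "norm y = 1" for x y :: 'a
  proof (cases "x = y")
    case True
    then have "x + y = 2 *\<^sub>R x" by (simp add: scaleR_2)
    then show ?thesis using xy True by simp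
  next
    case False
    let ?S = "{1 - norm ((1/2) *\<^sub>R (u + v)) | u v :: 'a.
                norm u = 1 \<and> norm v = 1 \<and> norm (u - v) \<ge> norm (x - y)}"
    have "bdd_below ?S"
    proof (rule bdd_belowI[of _ 0])
      fix s assume "s \<in> ?S"
      then obtain u v :: 'a where s: "s = 1 - norm ((1/2) *\<^sub>R (u + v))" "norm u = 1" "norm v = 1"
        by blast
      then show "0 \<le> s" using norm_triangle_ineq[of u v] by simp
    qed
    then have "Inf ?S \<le> 1 - norm ((1/2) *\<^sub>R (x + y))"
      using xy by (intro cInf_lower) auto
    moreover have "norm (x - y) \<le> 2" using norm_triangle_ineq4[of x y] xy by simp
    ultimately show ?thesis
      using K(2)[of "norm (x - y)"] False by (simp add: modulus_of_convexity_def)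
  qed
  then show ?thesis using that K(1) by blast
qed

text \<open>By symmetry of the unit sphere, an upper bound for \<open>\<phi>\<close> there also
  bounds its absolute value; homogeneity turns this into a bound on
  \<open>norm \<phi>\<close>.\<close>

lemma blinfun_real_sup_unit:
  fixes \<phi> :: "'a::real_normed_vector \<Rightarrow>\<^sub>L real"
  assumes "0 \<le> e" "e < norm \<phi>"
  shows "\<exists>x. norm x = 1 \<and> e < blinfun_apply \<phi> x"
proof (rule ccontr)
  assume "\<not> ?thesis"
  then have le: "blinfun_apply \<phi> x \<le> e" if "norm x = 1" for x using that by force
  have "norm (blinfun_apply \<phi> x) \<le> e * norm x" for x
  proof (cases "x = 0")
    case False
    have "blinfun_apply \<phi> ((1 / norm x) *\<^sub>R x) \<le> e" "blinfun_apply \<phi> ((1 / norm x) *\<^sub>R (- x)) \<le> e"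
      using False by (auto intro!: le)
    then show ?thesis
      using False by (simp add: blinfun.scaleR_right blinfun.minus_right field_simps abs_le_iff)
  qed (simp add: blinfun.zero_right)
  then have "norm \<phi> \<le> e" using assms(1) by (intro norm_blinfun_bound)
  with assms show False by simp
qed

text \<open>Unit vectors that nearly maximize \<open>\<phi>\<close> have midpoints of norm close to
  1, so uniform convexity draws them together: a maximizing sequence is Cauchy, and
  \<open>\<phi>\<close> attains its norm at the limit.\<close>

lemma norm_attained:
  fixes \<phi> :: "'a::banach \<Rightarrow>\<^sub>L real"
  assumes "two_uniformly_convex TYPE('a)" "\<phi> \<noteq> 0"
  shows "\<exists>x. norm x = 1 \<and> blinfun_apply \<phi> x = norm \<phi>"
proof -
  obtain K where K: "K > 0" "\<And>x y::'a. norm x = 1 \<Longrightarrow> norm y = 1 \<Longrightarrow>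
       norm ((1/2) *\<^sub>R (x + y)) \<le> 1 - K * (norm (x - y))\<^sup>2"
    using two_uniformly_convexD[OF assms(1)] by blast
  have pos: "norm \<phi> > 0" using assms(2) by simp
  \<comment> \<open>These levels increase from \<open>r 0 = 0\<close> to \<open>norm \<phi>\<close>
    without reaching it, so each is exceeded at some unit vector.\<close>
  define r where "r n = norm \<phi> * (1 - inverse (real (Suc n)))" for n
  have r: "0 \<le> r n" "r n < norm \<phi>" for n
    using pos by (auto simp: r_def field_simps)
  then have "\<forall>n. \<exists>x. norm x = 1 \<and> r n < blinfun_apply \<phi> x"
    using blinfun_real_sup_unit by blast
  then obtain X where X: "\<And>n. norm (X n) = 1" "\<And>n. r n < blinfun_apply \<phi> (X n)"
    by metis
  \<comment> \<open>The value of \<open>\<phi>\<close> at the midpoint is at least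
    \<open>r N\<close> and at most \<open>norm \<phi>\<close> times the norm of the midpoint;
    dividing by \<open>norm \<phi>\<close> leaves the estimate.\<close>
  have close: "K * (norm (X n - X k))\<^sup>2 \<le> inverse (real (Suc N))" if "N \<le> n" "N \<le> k" for n k N
  proof -
    have rN: "r N \<le> r n" "r N \<le> r k"
      using that pos by (auto simp: r_def intro!: mult_left_mono le_imp_inverse_le)
    have "r N \<le> blinfun_apply \<phi> ((1/2) *\<^sub>R (X n + X k))"
      using rN X(2)[of n] X(2)[of k] by (simp add: blinfun.scaleR_right blinfun.add_right)
    also have "\<dots> \<le> norm \<phi> * norm ((1/2) *\<^sub>R (X n + X k))"
      using norm_blinfun[of \<phi>] by (metis abs_ge_self order_trans real_norm_def)
    also have "\<dots> \<le> norm \<phi> * (1 - K * (norm (X n - X k))\<^sup>2)"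
      using K(2) X(1) by (intro mult_left_mono) auto
    finally show ?thesis using pos by (simp add: r_def)
  qed
  have "Cauchy X"
  proof (rule metric_CauchyI)
    fix e :: real assume "e > 0"
    then have "0 < K * e\<^sup>2" using K(1) by simp
    then obtain N where N: "inverse (real (Suc N)) < K * e\<^sup>2" using reals_Archimedean by blast
    have "dist (X n) (X k) < e" if "n \<ge> N" "k \<ge> N" for n k
    proof -
      have "K * (norm (X n - X k))\<^sup>2 < K * e\<^sup>2" using close[OF that] N by linarith
      then have "(norm (X n - X k))\<^sup>2 < e\<^sup>2" using K(1) by simp
      then show ?thesis using \<open>e > 0\<close> by (simp add: dist_norm power_less_imp_less_base)
    qed
    then show "\<exists>M. \<forall>m\<ge>M. \<forall>n\<ge>M. dist (X m) (X n) < e" by blast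
  qed
  then obtain x where x: "X \<longlonglongrightarrow> x" using Cauchy_convergent_iff convergent_def by blast
  have "norm x = 1" using tendsto_norm[OF x] X(1) by (simp add: LIMSEQ_const_iff)
  moreover have "norm \<phi> \<le> blinfun_apply \<phi> x"
  proof (rule LIMSEQ_le)
    show "r \<longlonglongrightarrow> norm \<phi>"
      unfolding r_def
      using tendsto_mult[OF tendsto_const tendsto_diff[OF tendsto_const LIMSEQ_inverse_real_of_nat],
          of "norm \<phi>" 1] by simp
    show "(\<lambda>n. blinfun_apply \<phi> (X n)) \<longlonglongrightarrow> blinfun_apply \<phi> x"
      by (intro tendsto_intros x)
    show "\<exists>N. \<forall>n\<ge>N. r n \<le> blinfun_apply \<phi> (X n)" using X(2) less_imp_le by blast
  qed
  moreover have "blinfun_apply \<phi> x \<le> norm \<phi> * norm x"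
    using norm_blinfun[of \<phi> x] by simp
  ultimately show ?thesis by (intro exI[of _ x]) simp
qed

text \<open>At the midpoint of two maximizers \<open>\<phi>\<close> again takes the value
  \<open>norm \<phi>\<close>, so the midpoint has norm at least 1, and convexity leaves no distance
  between the two.\<close>

lemma norm_attained_unique:
  fixes \<phi> :: "'a::real_normed_vector \<Rightarrow>\<^sub>L real"
  assumes "two_uniformly_convex TYPE('a)" "\<phi> \<noteq> 0"
    and "norm x = 1" "blinfun_apply \<phi> x = norm \<phi>" "norm y = 1" "blinfun_apply \<phi> y = norm \<phi>"
  shows "x = y"
proof -
  obtain K where K: "K > 0" "\<And>x y::'a. norm x = 1 \<Longrightarrow> norm y = 1 \<Longrightarrow>
       norm ((1/2) *\<^sub>R (x + y)) \<le> 1 - K * (norm (x - y))\<^sup>2"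
    using two_uniformly_convexD[OF assms(1)] by blast
  have "norm \<phi> * 1 = blinfun_apply \<phi> ((1/2) *\<^sub>R (x + y))"
    using assms by (simp add: blinfun.scaleR_right blinfun.add_right)
  also have "\<dots> \<le> norm \<phi> * norm ((1/2) *\<^sub>R (x + y))"
    using norm_blinfun[of \<phi>] by (metis abs_ge_self order_trans real_norm_def)
  finally have "1 \<le> norm ((1/2) *\<^sub>R (x + y))"
    using assms(2) mult_le_cancel_left_pos zero_less_norm_iff by blast
  then have "K * (norm (x - y))\<^sup>2 \<le> 0" using K(2)[OF assms(3,5)] by linarith
  then have "(norm (x - y))\<^sup>2 \<le> 0" using K(1) by (simp add: mult_le_0_iff)
  then show ?thesis by simp
qed

text \<open>The preimage of a nonzero functional has to be its norm times a unit vector where that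
  norm is attained; such a vector exists and is unique.\<close>

lemma bij_duality_map:
  assumes "smooth_space TYPE('a::banach)" "two_uniformly_convex TYPE('a)"
  shows "bij (duality_map :: 'a \<Rightarrow> _)"
proof (rule bijI)
  show "inj (duality_map :: 'a \<Rightarrow> _)"
  proof (rule injI)
    fix x y :: 'a assume eq: "duality_map x = duality_map y"
    then have nxy: "norm x = norm y" using norm_duality_map[OF assms(1)] by metis
    show "x = y"
    proof (cases "x = 0")
      case False
      then have "norm x > 0" by simp
      have "(1 / norm x) *\<^sub>R x = (1 / norm x) *\<^sub>R y"
      proof (rule norm_attained_unique[OF assms(2), of "duality_map x"])
        show "duality_map x \<noteq> 0" using False norm_duality_map[OF assms(1), of x] by auto
        show "blinfun_apply (duality_map x) ((1 / norm x) *\<^sub>R x) = norm (duality_map x)"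
          "blinfun_apply (duality_map x) ((1 / norm x) *\<^sub>R y) = norm (duality_map x)"
          using False nxy eq duality_map_self[OF assms(1), of x] duality_map_self[OF assms(1), of y]
          by (simp_all add: blinfun.scaleR_right norm_duality_map[OF assms(1)] power2_eq_square)
      qed (use False nxy in auto)
      then show ?thesis using False by simp
    qed (use nxy in auto)
  qed
  have "\<exists>x. duality_map x = \<phi>" for \<phi> :: "'a \<Rightarrow>\<^sub>L real"
  proof (cases "\<phi> = 0")
    case True
    then have "duality_map (0::'a) = \<phi>" by (intro duality_map_eqI[OF assms(1)]) auto
    then show ?thesis by blast
  next
    case False
    then obtain x where x: "norm x = 1" "blinfun_apply \<phi> x = norm \<phi>"
      using norm_attained[OF assms(2)] by blast
    then have "duality_map (norm \<phi> *\<^sub>R x) = \<phi>"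
      by (intro duality_map_eqI[OF assms(1)]) (auto simp: blinfun.scaleR_right power2_eq_square)
    then show ?thesis by blast
  qed
  then show "surj (duality_map :: 'a \<Rightarrow> _)" unfolding surj_def by metis
qed

section \<open>Existence and boundedness of the generalized adjoint\<close>

text \<open>The identity amounts to \<open>duality_map (B y) = duality_map y o\<^sub>L A\<close>.
  Surjectivity of the duality map solves it, injectivity makes the solution unique, and so
  \<open>THE\<close> in \<open>gen_adjoint\<close> picks it.\<close>

lemma sip_gen_adjoint:
  fixes A :: "'a::banach \<Rightarrow>\<^sub>L 'b::real_normed_vector"
  assumes "smooth_space TYPE('a)" "two_uniformly_convex TYPE('a)"
  shows "sip (blinfun_apply A x) y = sip x (gen_adjoint A y)"
proof -
  have bij: "bij (duality_map :: 'a \<Rightarrow> _)" using bij_duality_map[OF assms] .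
  have "\<exists>!B. \<forall>x y. sip (blinfun_apply A x) y = sip x (B y)"
  proof (rule ex1I)
    show "\<forall>x y. sip (blinfun_apply A x) y = sip x (inv duality_map (duality_map y o\<^sub>L A))"
      by (simp add: sip_def surj_f_inv_f[OF bij_is_surj[OF bij]])
  next
    fix B assume B: "\<forall>x y. sip (blinfun_apply A x) y = sip x (B y)"
    have "duality_map (B y) = duality_map y o\<^sub>L A" for y
      using B by (intro blinfun_eqI) (simp add: sip_def)
    then show "B = (\<lambda>y. inv duality_map (duality_map y o\<^sub>L A))"
      by (metis bij bij_is_inj inv_f_f)
  qed
  from theI'[OF this] show ?thesis unfolding gen_adjoint_def by blast
qed

lemma norm_gen_adjoint_le:
  fixes A :: "'a::banach \<Rightarrow>\<^sub>L 'b::real_normed_vector"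
  assumes "smooth_space TYPE('a)" "two_uniformly_convex TYPE('a)" "smooth_space TYPE('b)"
  shows "norm (gen_adjoint A y) \<le> norm A * norm y"
proof -
  have "duality_map (gen_adjoint A y) = duality_map y o\<^sub>L A"
    using sip_gen_adjoint[OF assms(1,2), of A]
    by (intro blinfun_eqI) (simp add: sip_def)
  then have "norm (gen_adjoint A y) = norm (duality_map y o\<^sub>L A)"
    using norm_duality_map[OF assms(1)] by metis
  also have "\<dots> \<le> norm (duality_map y) * norm A" by (rule norm_blinfun_compose)
  finally show ?thesis by (simp add: norm_duality_map[OF assms(3)] mult.commute)
qed

text \<open>The infimum of the admissible bounds is itself admissible, being at least every quotient
  \<open>norm (T y) / norm y\<close>; hence the minimum in \<open>opnorm\<close> is
  attained.\<close>

lemma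
  assumes "0 \<le> M" "\<And>y. norm (T y) \<le> M * norm y"
  shows opnorm_nonneg: "0 \<le> opnorm T"
    and norm_le_opnorm: "norm (T y) \<le> opnorm T * norm y"
proof -
  define S where "S = {M. 0 \<le> M \<and> (\<forall>y. norm (T y) \<le> M * norm y)}"
  have S: "S \<noteq> {}" "bdd_below S" using assms by (auto simp: S_def intro!: bdd_belowI[of _ 0])
  have Inf: "Inf S \<in> S"
  proof -
    have "norm (T y) \<le> Inf S * norm y" for y
    proof (cases "y = 0")
      case True
      then show ?thesis using assms(2)[of y] by simp
    next
      case False
      have "norm (T y) / norm y \<le> Inf S"
        using S False by (intro cInf_greatest) (auto simp: S_def divide_simps)
      then show ?thesis using False by (simp add: divide_simps)
    qed
    moreover have "0 \<le> Inf S" using S by (intro cInf_greatest) (auto simp: S_def)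
    ultimately show ?thesis by (simp add: S_def)
  qed
  have "opnorm T = Inf S"
    unfolding opnorm_def
  proof (rule Least_equality)
    show "0 \<le> Inf S \<and> (\<forall>y. norm (T y) \<le> Inf S * norm y)" using Inf by (simp add: S_def)
  next
    fix N assume "0 \<le> N \<and> (\<forall>y. norm (T y) \<le> N * norm y)"
    then show "Inf S \<le> N" using S by (intro cInf_lower) (auto simp: S_def)
  qed
  then show "0 \<le> opnorm T" "norm (T y) \<le> opnorm T * norm y" using Inf by (auto simp: S_def)
qed

section \<open>Sunny nonexpansive retractions\<close>

text \<open>\<open>Q\<close> is constant along the ray from \<open>Q x\<close> through
  \<open>x\<close>, so nonexpansiveness shows that moving along this ray never gets closer to
  \<open>y\<close> than \<open>Q x\<close> is. The smoothness inequality extracts the first-order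
  term of this statement.\<close>

lemma sunny_retraction_variational:
  fixes C :: "'a::real_normed_vector set"
  assumes sm: "smooth_space TYPE('a)" and c: "smoothness_bound TYPE('a) c" "c > 0"
    and Q: "sunny_nonexpansive_retraction C Q" and y: "y \<in> C"
  shows "sip (x - Q x) (y - Q x) \<le> 0"
proof -
  define w v where "w = Q x - y" and "v = x - Q x"
  have ineq: "0 \<le> 2 * sip v w + t * (c * (norm v)\<^sup>2)" if t: "t > 0" for t
  proof -
    have "norm w = norm (Q (Q x + t *\<^sub>R v) - Q y)"
      using Q y t by (simp add: sunny_nonexpansive_retraction_def w_def v_def)
    also have "\<dots> \<le> norm (w + t *\<^sub>R v)"
      using Q unfolding sunny_nonexpansive_retraction_def w_def
      by (metis (no_types, lifting) add_diff_eq diff_add_eq)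
    finally have "(norm w)\<^sup>2 \<le> (norm (w + t *\<^sub>R v))\<^sup>2" by (simp add: power_mono)
    also have "\<dots> \<le> (norm w)\<^sup>2 + 2 * sip (t *\<^sub>R v) w + c * (norm (t *\<^sub>R v))\<^sup>2"
      using c unfolding smoothness_bound_def by blast
    finally have "0 \<le> t * (2 * sip v w + t * (c * (norm v)\<^sup>2))"
      by (simp add: sip_scaleR_left algebra_simps power2_eq_square)
    then show ?thesis using t by (simp add: zero_le_mult_iff)
  qed
  \<comment> \<open>After division by \<open>t\<close>, letting \<open>t\<close> decrease to 0
    removes the quadratic remainder.\<close>
  have "((\<lambda>t. 2 * sip v w + t * (c * (norm v)\<^sup>2)) \<longlongrightarrow> 2 * sip v w + 0 * (c * (norm v)\<^sup>2))
          (at_right 0)"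
    by (intro tendsto_intros)
  then have "0 \<le> 2 * sip v w + 0 * (c * (norm v)\<^sup>2)"
    by (rule tendsto_lowerbound) (auto intro!: eventually_at_rightI[of 0 1] ineq)
  moreover have "sip v (y - Q x) = - sip v w"
    using sip_minus_right[OF sm, of v w] by (simp add: w_def)
  ultimately show ?thesis by (simp add: v_def)
qed

text \<open>Both \<open>q\<close> and \<open>Q u\<close> satisfy the variational inequality. Tested
  against each other and brought to the common second argument \<open>q - Q u\<close>, the two
  inequalities add up to \<open>(norm (q - Q u))\<^sup>2 \<le> 0\<close>.\<close>

lemma sunny_retraction_eqI:
  fixes C :: "'a::real_normed_vector set"
  assumes sm: "smooth_space TYPE('a)" and c: "smoothness_bound TYPE('a) c" "c > 0"
    and Q: "sunny_nonexpansive_retraction C Q" and q: "q \<in> C"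
    and vi: "\<And>z. z \<in> C \<Longrightarrow> sip (q - u) (z - q) \<ge> 0"
  shows "Q u = q"
proof -
  have "sip (u - Q u) (q - Q u) \<le> 0"
    by (rule sunny_retraction_variational[OF sm c Q q])
  moreover have "sip (q - u) (Q u - q) \<ge> 0"
    using Q by (intro vi) (simp add: sunny_nonexpansive_retraction_def)
  then have "sip (q - u) (q - Q u) \<le> 0"
    using sip_minus_right[OF sm, of "q - u" "Q u - q"] by simp
  ultimately have "sip ((u - Q u) + (q - u)) (q - Q u) \<le> 0" by (simp only: sip_add_left)
  then have "sip (q - Q u) (q - Q u) \<le> 0" by (simp add: algebra_simps)
  then show ?thesis by (simp add: sip_self[OF sm])
qed

section \<open>The contraction estimate\<close>

text \<open>In the smoothness inequality for \<open>u - v\<close> with increment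
  \<open>- l *\<^sub>R (T u - T v)\<close>, monotonicity controls the cross term and the Lipschitz
  bound the quadratic one.\<close>

lemma forward_step_bound:
  fixes T :: "'a::real_normed_vector \<Rightarrow> 'a"
  assumes c: "smoothness_bound TYPE('a) c" "c > 0"
    and T: "strongly_monotone_on C \<alpha> T" "lipschitz_continuous_on C \<beta> T"
    and "0 \<le> l" "u \<in> C" "v \<in> C"
  shows "(norm ((u - l *\<^sub>R T u) - (v - l *\<^sub>R T v)))\<^sup>2
           \<le> (1 - 2 * l * \<alpha> + c * l\<^sup>2 * \<beta>\<^sup>2) * (norm (u - v))\<^sup>2"
proof -
  define d w where "d = u - v" and "w = T u - T v"
  have mono: "\<alpha> * (norm d)\<^sup>2 \<le> sip w d" and lip: "norm w \<le> \<beta> * norm d"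
    using T assms(6,7)
    by (auto simp: strongly_monotone_on_def lipschitz_continuous_on_def d_def w_def)
  have "(u - l *\<^sub>R T u) - (v - l *\<^sub>R T v) = d + (- l) *\<^sub>R w"
    by (simp add: d_def w_def algebra_simps)
  then have "(norm ((u - l *\<^sub>R T u) - (v - l *\<^sub>R T v)))\<^sup>2
      \<le> (norm d)\<^sup>2 + 2 * sip ((- l) *\<^sub>R w) d + c * (norm ((- l) *\<^sub>R w))\<^sup>2"
    using c(1) unfolding smoothness_bound_def by metis
  also have "\<dots> = (norm d)\<^sup>2 - 2 * (l * sip w d) + c * l\<^sup>2 * (norm w)\<^sup>2"
    using \<open>0 \<le> l\<close> by (simp add: sip_scaleR_left sip_minus_left power_mult_distrib)
  also have "\<dots> \<le> (norm d)\<^sup>2 - 2 * (l * (\<alpha> * (norm d)\<^sup>2)) + c * l\<^sup>2 * (\<beta> * norm d)\<^sup>2"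
  proof -
    have "l * (\<alpha> * (norm d)\<^sup>2) \<le> l * sip w d" using mono \<open>0 \<le> l\<close> by (rule mult_left_mono)
    moreover have "c * l\<^sup>2 * (norm w)\<^sup>2 \<le> c * l\<^sup>2 * (\<beta> * norm d)\<^sup>2"
      using lip c(2) by (intro mult_left_mono power_mono) auto
    ultimately show ?thesis by linarith
  qed
  also have "\<dots> = (1 - 2 * l * \<alpha> + c * l\<^sup>2 * \<beta>\<^sup>2) * (norm d)\<^sup>2"
    by (simp add: algebra_simps power_mult_distrib)
  finally show ?thesis by (simp add: d_def)
qed

text \<open>Completing the square: with \<open>k = c * \<beta>\<^sup>2\<close>, \<open>k\<close>
  times the difference of the two sides is \<open>(k * l - \<alpha>)\<^sup>2 - D\<close>, whose
  roots in \<open>l\<close> are the ends of the interval.\<close>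

lemma step_size_bound:
  fixes \<alpha> \<beta> c l p :: real
  assumes "\<beta> > 0" "c > 0"
    and lower: "(\<alpha> - sqrt (\<alpha>\<^sup>2 - c * \<beta>\<^sup>2 * (1 - p\<^sup>2))) / (c * \<beta>\<^sup>2) < l"
    and upper: "l < (\<alpha> + sqrt (\<alpha>\<^sup>2 - c * \<beta>\<^sup>2 * (1 - p\<^sup>2))) / (c * \<beta>\<^sup>2)"
  shows "1 - 2 * l * \<alpha> + c * l\<^sup>2 * \<beta>\<^sup>2 < p\<^sup>2"
proof -
  define k D where "k = c * \<beta>\<^sup>2" and "D = \<alpha>\<^sup>2 - k * (1 - p\<^sup>2)"
  have k: "k > 0" using assms by (simp add: k_def)
  have lt: "\<alpha> - sqrt D < k * l" "k * l < \<alpha> + sqrt D"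
    using lower upper k by (auto simp: k_def[symmetric] D_def divide_simps mult.commute)
  then have abs: "\<bar>k * l - \<alpha>\<bar> < sqrt D" by linarith
  \<comment> \<open>\<open>sqrt D\<close> exceeds an absolute value, so \<open>D\<close> is positive
    and squaring the root returns \<open>D\<close>.\<close>
  then have "D > 0" by (metis abs_ge_zero le_less_trans real_sqrt_gt_0_iff)
  from abs have "\<bar>k * l - \<alpha>\<bar>\<^sup>2 < (sqrt D)\<^sup>2" by (intro power_strict_mono) auto
  then have "(k * l - \<alpha>)\<^sup>2 < D" using \<open>D > 0\<close> by simp
  then have "k * (1 - 2 * l * \<alpha> + k * l\<^sup>2 - p\<^sup>2) < 0"
    by (simp add: D_def power2_eq_square algebra_simps)
  then have "1 - 2 * l * \<alpha> + k * l\<^sup>2 - p\<^sup>2 < 0" using k by (simp add: mult_less_0_iff)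
  then show ?thesis by (simp add: k_def algebra_simps)
qed

text \<open>One half of the unrelaxed iteration, stated for generic data so that it serves both
  \<open>F\<close>, \<open>f\<close> and \<open>G\<close>, \<open>g\<close>. The factor
  \<open>(1 + m) * \<tau> + m * \<theta>\<close> is below 1 exactly when
  \<open>\<tau> < p\<close>.\<close>

lemma split_step_contraction:
  fixes C1 :: "'a::real_normed_vector set" and C2 :: "'b::real_normed_vector set"
    and A :: "'a \<Rightarrow>\<^sub>L 'b" and B :: "'b \<Rightarrow> 'a"
  assumes c1: "smoothness_bound TYPE('a) c1" "c1 > 0"
    and c2: "smoothness_bound TYPE('b) c2" "c2 > 0"
    and Q1: "sunny_nonexpansive_retraction C1 Q1" and Q2: "sunny_nonexpansive_retraction C2 Q2"
    and F: "strongly_monotone_on C1 \<alpha> F" "lipschitz_continuous_on C1 \<beta> F"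
    and f: "strongly_monotone_on C2 \<sigma> f" "lipschitz_continuous_on C2 \<eta> f"
    and pos: "0 < lam" "0 < gam" "0 < rho"
    and B: "0 \<le> M" "\<And>v. norm (B v) \<le> M * norm v"
    and m: "m = rho * M * norm A"
    and \<theta>: "\<theta> = sqrt (1 - 2 * gam * \<sigma> + c2 * gam\<^sup>2 * \<eta>\<^sup>2)"
      "0 \<le> 1 - 2 * gam * \<sigma> + c2 * gam\<^sup>2 * \<eta>\<^sup>2"
    and p: "p = (1 - m * \<theta>) / (1 + m)" "0 \<le> p"
    and lt: "1 - 2 * lam * \<alpha> + c1 * lam\<^sup>2 * \<beta>\<^sup>2 < p\<^sup>2"
    and y1: "y1 \<in> C1" "blinfun_apply A y1 \<in> C2"
    and x1: "Q1 (y1 - lam *\<^sub>R F y1) = x1"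
      "Q2 (blinfun_apply A y1 - gam *\<^sub>R f (blinfun_apply A y1)) = blinfun_apply A x1"
  shows "\<exists>k. 0 \<le> k \<and> k < 1 \<and> (\<forall>y\<in>C1. blinfun_apply A y \<in> C2 \<longrightarrow>
    norm (Q1 (y - lam *\<^sub>R F y)
      + rho *\<^sub>R B (Q2 (blinfun_apply A y - gam *\<^sub>R f (blinfun_apply A y))
                    - blinfun_apply A (Q1 (y - lam *\<^sub>R F y))) - x1) \<le> k * norm (y - y1))"
proof -
  define s where "s = 1 - 2 * lam * \<alpha> + c1 * lam\<^sup>2 * \<beta>\<^sup>2"
  \<comment> \<open>\<open>s\<close> may be negative, but only when \<open>C1\<close> is a single point; \<open>\<tau>\<close> could then equal \<open>p\<close>.\<close>
  define \<tau> where "\<tau> = sqrt (max 0 s)"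
  define k where "k = (if s < 0 then 0 else (1 + m) * \<tau> + m * \<theta>)"
  have m0: "0 \<le> m" using m pos B(1) by simp
  have \<theta>0: "0 \<le> \<theta>" using \<theta> by simp
  have \<tau>0: "0 \<le> \<tau>" by (simp add: \<tau>_def)
  have k0: "0 \<le> k" using m0 \<theta>0 \<tau>0 by (simp add: k_def)
  have k1: "k < 1"
  proof (cases "s < 0")
    case False
    then have "\<tau>\<^sup>2 < p\<^sup>2" using lt by (simp add: \<tau>_def s_def)
    then have "\<tau> < p" using p(2) by (rule power_less_imp_less_base)
    then have "(1 + m) * \<tau> < 1 - m * \<theta>" using p(1) m0 by (simp add: field_simps)
    then show ?thesis using False by (simp add: k_def)
  qed (simp add: k_def)
  have "norm (Q1 (y - lam *\<^sub>R F y)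
      + rho *\<^sub>R B (Q2 (blinfun_apply A y - gam *\<^sub>R f (blinfun_apply A y))
                    - blinfun_apply A (Q1 (y - lam *\<^sub>R F y))) - x1) \<le> k * norm (y - y1)"
    if y: "y \<in> C1" "blinfun_apply A y \<in> C2" for y
  proof -
    define a1 where "a1 = Q1 (y - lam *\<^sub>R F y)"
    define a2 where "a2 = Q2 (blinfun_apply A y - gam *\<^sub>R f (blinfun_apply A y))"
    have fwd1: "(norm ((y - lam *\<^sub>R F y) - (y1 - lam *\<^sub>R F y1)))\<^sup>2 \<le> s * (norm (y - y1))\<^sup>2"
      unfolding s_def using forward_step_bound[OF c1 F _ y(1) y1(1)] pos(1) by simp
    have "norm (a1 - x1) \<le> norm ((y - lam *\<^sub>R F y) - (y1 - lam *\<^sub>R F y1))"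
      using Q1 x1(1) unfolding sunny_nonexpansive_retraction_def a1_def by metis
    also have "\<dots> \<le> \<tau> * norm (y - y1)"
    proof (rule power2_le_imp_le)
      have "s * (norm (y - y1))\<^sup>2 \<le> max 0 s * (norm (y - y1))\<^sup>2" by (intro mult_right_mono) auto
      then show "(norm ((y - lam *\<^sub>R F y) - (y1 - lam *\<^sub>R F y1)))\<^sup>2 \<le> (\<tau> * norm (y - y1))\<^sup>2"
        using fwd1 by (simp add: \<tau>_def power_mult_distrib)
    qed (use \<tau>0 in simp)
    finally have a1: "norm (a1 - x1) \<le> \<tau> * norm (y - y1)" .
    have "norm (a2 - blinfun_apply A x1) \<le> norm ((blinfun_apply A y - gam *\<^sub>R f (blinfun_apply A y))
            - (blinfun_apply A y1 - gam *\<^sub>R f (blinfun_apply A y1)))"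
      using Q2 x1(2) unfolding sunny_nonexpansive_retraction_def a2_def by metis
    also have "\<dots> \<le> \<theta> * norm (blinfun_apply A y - blinfun_apply A y1)"
    proof (rule power2_le_imp_le)
      show "(norm ((blinfun_apply A y - gam *\<^sub>R f (blinfun_apply A y))
            - (blinfun_apply A y1 - gam *\<^sub>R f (blinfun_apply A y1))))\<^sup>2
            \<le> (\<theta> * norm (blinfun_apply A y - blinfun_apply A y1))\<^sup>2"
        using forward_step_bound[OF c2 f _ y(2) y1(2), of gam] pos(2) \<theta>
        by (simp add: power_mult_distrib)
    qed (use \<theta>0 in simp)
    also have "\<dots> \<le> \<theta> * (norm A * norm (y - y1))"
      using \<theta>0 norm_blinfun[of A "y - y1"]
      by (intro mult_left_mono) (auto simp: blinfun.diff_right)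
    finally have a2: "norm (a2 - blinfun_apply A x1) \<le> \<theta> * (norm A * norm (y - y1))" .
    \<comment> \<open>Inserting \<open>A x1\<close> splits the residual into the error of
      \<open>a2\<close> and the image under \<open>A\<close> of the error of
      \<open>a1\<close>.\<close>
    have "norm (a2 - blinfun_apply A a1)
        \<le> norm (a2 - blinfun_apply A x1) + norm (blinfun_apply A (a1 - x1))"
      using norm_triangle_ineq4[of "a2 - blinfun_apply A x1" "blinfun_apply A (a1 - x1)"]
      by (simp add: blinfun.diff_right)
    also have "\<dots> \<le> \<theta> * (norm A * norm (y - y1)) + norm A * (\<tau> * norm (y - y1))"
    proof -
      have "norm (blinfun_apply A (a1 - x1)) \<le> norm A * norm (a1 - x1)" by (rule norm_blinfun)
      also have "\<dots> \<le> norm A * (\<tau> * norm (y - y1))" using a1 by (intro mult_left_mono) auto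
      finally show ?thesis using a2 by linarith
    qed
    finally have diff: "norm (a2 - blinfun_apply A a1) \<le> norm A * (\<theta> + \<tau>) * norm (y - y1)"
      by (simp add: algebra_simps)
    have "norm (a1 + rho *\<^sub>R B (a2 - blinfun_apply A a1) - x1)
        \<le> norm (a1 - x1) + rho * norm (B (a2 - blinfun_apply A a1))"
      using norm_triangle_ineq[of "a1 - x1" "rho *\<^sub>R B (a2 - blinfun_apply A a1)"] pos(3)
      by (simp add: algebra_simps)
    also have "\<dots> \<le> \<tau> * norm (y - y1) + rho * (M * (norm A * (\<theta> + \<tau>) * norm (y - y1)))"
      using a1 order_trans[OF B(2) mult_left_mono[OF diff B(1)]] pos(3)
      by (intro add_mono mult_left_mono) auto
    also have "\<dots> = ((1 + m) * \<tau> + m * \<theta>) * norm (y - y1)" by (simp add: m algebra_simps)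
    also have "\<dots> \<le> k * norm (y - y1)"
    proof (cases "s < 0")
      case True
      \<comment> \<open>A negative \<open>s\<close> makes the right-hand side of \<open>fwd1\<close>
        nonpositive, which forces \<open>y = y1\<close>.\<close>
      then have "(norm (y - y1))\<^sup>2 \<le> 0"
        using order_trans[OF zero_le_power2 fwd1] by (simp add: zero_le_mult_iff)
      then show ?thesis by simp
    qed (simp add: k_def)
    finally show ?thesis by (simp add: a1_def a2_def)
  qed
  with k0 k1 show ?thesis by blast
qed

section \<open>Strong convergence of the relaxed iteration\<close>

text \<open>By \<open>1 - t \<le> exp (- t)\<close> the product of the factors is at most the
  exponential of \<open>- r\<close> times the partial sum. The sum starts at index 1, so the
  estimate starts from \<open>S 1\<close>.\<close>

lemma relaxed_contraction_tendsto_0: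
  fixes S a :: "nat \<Rightarrow> real"
  assumes S: "\<And>n. 0 \<le> S n" "\<And>n. S (Suc n) \<le> (1 - a n * r) * S n" and r: "r > 0"
    and a: "filterlim (\<lambda>N. \<Sum>n=1..N. a n) at_top at_top"
  shows "S \<longlonglongrightarrow> 0"
proof -
  have le: "S (Suc N) \<le> S 1 * exp (- (r * (\<Sum>n=1..N. a n)))" for N
  proof (induction N)
    case (Suc N)
    have "S (Suc (Suc N)) \<le> (1 - a (Suc N) * r) * S (Suc N)" by (rule S)
    also have "\<dots> \<le> exp (- (a (Suc N) * r)) * S (Suc N)"
      using exp_ge_add_one_self[of "- (a (Suc N) * r)"] S(1) by (intro mult_right_mono) auto
    also have "\<dots> \<le> exp (- (a (Suc N) * r)) * (S 1 * exp (- (r * (\<Sum>n=1..N. a n))))"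
      using Suc by (intro mult_left_mono) auto
    also have "\<dots> = S 1 * exp (- (r * (\<Sum>n=1..Suc N. a n)))"
      by (simp add: exp_add[symmetric] algebra_simps)
    finally show ?case .
  qed simp
  have "filterlim (\<lambda>N. r * (\<Sum>n=1..N. a n)) at_top sequentially"
    by (rule filterlim_tendsto_pos_mult_at_top[OF tendsto_const r a])
  then have "((\<lambda>N. exp (- (r * (\<Sum>n=1..N. a n)))) \<longlongrightarrow> 0) sequentially"
    by (intro filterlim_compose[OF exp_at_bot]) (simp add: filterlim_uminus_at_top[symmetric])
  then have lim: "(\<lambda>N. S 1 * exp (- (r * (\<Sum>n=1..N. a n)))) \<longlonglongrightarrow> 0"
    by (rule tendsto_mult_right_zero)
  have "(\<lambda>N. S (Suc N)) \<longlonglongrightarrow> 0"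
    by (rule tendsto_sandwich[OF _ _ tendsto_const lim]) (auto simp: S(1) le[unfolded One_nat_def])
  then show ?thesis by (rule LIMSEQ_imp_Suc)
qed

theorem theorem3p1:
  fixes C1 :: "'a::banach set" and C2 :: "'b::banach set"
    and Q1 F G :: "'a \<Rightarrow> 'a" and Q2 f g :: "'b \<Rightarrow> 'b"
    and A :: "'a \<Rightarrow>\<^sub>L 'b"
    and c1 c2 lam gam rho m :: real
    and \<alpha> \<beta> \<sigma> \<eta> p \<theta> :: "nat \<Rightarrow> real"
    and a :: "nat \<Rightarrow> real" and xs ys :: "nat \<Rightarrow> 'a" and x1 y1 :: 'a
  assumes "smooth_space TYPE('a)" and "two_uniformly_convex TYPE('a)"
    and "smooth_space TYPE('b)" and "two_uniformly_convex TYPE('b)"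
    and "constant_of_smoothness TYPE('a) c1" and "constant_of_smoothness TYPE('b) c2"
    and "C1 \<noteq> {}" and "closed C1" and "convex C1"
    and "C2 \<noteq> {}" and "closed C2" and "convex C2"
    and "sunny_nonexpansive_retraction C1 Q1" and "sunny_nonexpansive_retraction C2 Q2"
    and "strongly_monotone_on C1 (\<alpha> 1) F" and "lipschitz_continuous_on C1 (\<beta> 1) F"
    and "strongly_monotone_on C1 (\<alpha> 2) G" and "lipschitz_continuous_on C1 (\<beta> 2) G"
    and "strongly_monotone_on C2 (\<sigma> 1) f" and "lipschitz_continuous_on C2 (\<eta> 1) f"
    and "strongly_monotone_on C2 (\<sigma> 2) g" and "lipschitz_continuous_on C2 (\<eta> 2) g"
    and "lam > 0" and "gam > 0" and "rho > 0"
    and "m = rho * opnorm (gen_adjoint A) * norm A"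
    and "\<forall>i\<in>{1,2}. \<theta> (i + 2) = sqrt (1 - 2 * gam * \<sigma> i + c2 * gam\<^sup>2 * (\<eta> i)\<^sup>2)"
    and "\<forall>i\<in>{1,2}. p i = (1 - m * \<theta> (i + 2)) / (1 + m)"
    \<comment> \<open>the root defining \<open>\<theta>\<close> is real (Isabelle's \<open>sqrt\<close> is total, with \<open>sqrt (- t) = - sqrt t\<close>)\<close>
    and "\<forall>i\<in>{1,2}. 0 \<le> 1 - 2 * gam * \<sigma> i + c2 * gam\<^sup>2 * (\<eta> i)\<^sup>2"
    \<comment> \<open>tacit in the source; the claim fails without it\<close>
    and "\<forall>i\<in>{1,2}. 0 \<le> p i"
    and "\<forall>i\<in>{1,2}. \<alpha> i > \<beta> i * sqrt (c1 * (1 - (p i)\<^sup>2))"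
    and "(MAX i\<in>{1,2}. (\<alpha> i - sqrt ((\<alpha> i)\<^sup>2 - c1 * (\<beta> i)\<^sup>2 * (1 - (p i)\<^sup>2))) / (c1 * (\<beta> i)\<^sup>2)) < lam"
    and "lam < (MIN i\<in>{1,2}. (\<alpha> i + sqrt ((\<alpha> i)\<^sup>2 - c1 * (\<beta> i)\<^sup>2 * (1 - (p i)\<^sup>2))) / (c1 * (\<beta> i)\<^sup>2))"
    and "SSpVIP_solution C1 C2 F G f g A lam gam x1 y1"
    and "\<forall>n. 0 < a n \<and> a n < 1"
    and "filterlim (\<lambda>N. \<Sum>n=1..N. a n) at_top at_top"
    and "generated_by_algorithm C1 C2 Q1 Q2 F G f g A lam gam rho a xs ys"
  shows "(\<lambda>n. (xs n, ys n)) \<longlonglongrightarrow> (x1, y1)"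
proof -
  note smE = assms(1) and smH = assms(3) and sol = assms(34) and gen = assms(37)
  note Q1 = assms(13) and Q2 = assms(14)
  have c: "smoothness_bound TYPE('a) c1" "c1 > 0" "smoothness_bound TYPE('b) c2" "c2 > 0"
    using assms(5,6) by (auto simp: constant_of_smoothness_def)
  define B where "B = gen_adjoint A"
  have B: "0 \<le> opnorm B" "norm (B v) \<le> opnorm B * norm v" for v
    using opnorm_nonneg norm_le_opnorm norm_gen_adjoint_le[OF assms(1-3), of A]
    unfolding B_def by (metis norm_ge_zero)+
  define x2 y2 where "x2 = blinfun_apply A x1" and "y2 = blinfun_apply A y1"
  \<comment> \<open>Each inequality is regrouped as retracted point minus forward step, the form
    required by \<open>sunny_retraction_eqI\<close>.\<close>
  have mem: "x1 \<in> C1" "y1 \<in> C1" "x2 \<in> C2" "y2 \<in> C2"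
    and vi: "\<And>z. z \<in> C1 \<Longrightarrow> sip (x1 - (y1 - lam *\<^sub>R F y1)) (z - x1) \<ge> 0"
      "\<And>z. z \<in> C2 \<Longrightarrow> sip (x2 - (y2 - gam *\<^sub>R f y2)) (z - x2) \<ge> 0"
      "\<And>z. z \<in> C1 \<Longrightarrow> sip (y1 - (x1 - lam *\<^sub>R G x1)) (z - y1) \<ge> 0"
      "\<And>z. z \<in> C2 \<Longrightarrow> sip (y2 - (x2 - gam *\<^sub>R g x2)) (z - y2) \<ge> 0"
    using sol unfolding SSpVIP_solution_def Let_def x2_def y2_def by (auto simp: algebra_simps)
  have fp: "Q1 (y1 - lam *\<^sub>R F y1) = x1" "Q2 (y2 - gam *\<^sub>R f y2) = x2"
    "Q1 (x1 - lam *\<^sub>R G x1) = y1" "Q2 (x2 - gam *\<^sub>R g x2) = y2"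
    using vi mem
    by (auto intro: sunny_retraction_eqI[OF smE c(1,2) Q1] sunny_retraction_eqI[OF smH c(3,4) Q2])
  have \<beta>: "\<beta> 1 > 0" "\<beta> 2 > 0" using assms(16,18) by (auto simp: lipschitz_continuous_on_def)
  \<comment> \<open>The maximum and minimum over two indices say that \<open>lam\<close> lies in
    both intervals.\<close>
  have lt: "1 - 2 * lam * \<alpha> 1 + c1 * lam\<^sup>2 * (\<beta> 1)\<^sup>2 < (p 1)\<^sup>2"
    "1 - 2 * lam * \<alpha> 2 + c1 * lam\<^sup>2 * (\<beta> 2)\<^sup>2 < (p 2)\<^sup>2"
    using assms(32,33) \<beta> c(2) by (auto intro!: step_size_bound)
  have \<theta>: "\<theta> 3 = sqrt (1 - 2 * gam * \<sigma> 1 + c2 * gam\<^sup>2 * (\<eta> 1)\<^sup>2)"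
    "\<theta> 4 = sqrt (1 - 2 * gam * \<sigma> 2 + c2 * gam\<^sup>2 * (\<eta> 2)\<^sup>2)"
    "0 \<le> 1 - 2 * gam * \<sigma> 1 + c2 * gam\<^sup>2 * (\<eta> 1)\<^sup>2"
    "0 \<le> 1 - 2 * gam * \<sigma> 2 + c2 * gam\<^sup>2 * (\<eta> 2)\<^sup>2"
    and p: "p 1 = (1 - m * \<theta> 3) / (1 + m)" "p 2 = (1 - m * \<theta> 4) / (1 + m)" "0 \<le> p 1" "0 \<le> p 2"
    using assms(27-30) by (auto simp del: One_nat_def)
  note m = assms(26)[folded B_def]
  \<comment> \<open>\<open>X\<close> and \<open>Y\<close> are the unrelaxed updates. They cross
    over: \<open>X\<close> approximates \<open>x1\<close> from a \<open>y\<close>-iterate, and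
    \<open>Y\<close> approximates \<open>y1\<close> from an \<open>x\<close>-iterate.\<close>
  define X where "X y = Q1 (y - lam *\<^sub>R F y)
      + rho *\<^sub>R B (Q2 (blinfun_apply A y - gam *\<^sub>R f (blinfun_apply A y))
                    - blinfun_apply A (Q1 (y - lam *\<^sub>R F y)))" for y
  define Y where "Y x = Q1 (x - lam *\<^sub>R G x)
      + rho *\<^sub>R B (Q2 (blinfun_apply A x - gam *\<^sub>R g (blinfun_apply A x))
                    - blinfun_apply A (Q1 (x - lam *\<^sub>R G x)))" for x
  obtain k1 where k1: "k1 < 1"
    "\<And>y. y \<in> C1 \<Longrightarrow> blinfun_apply A y \<in> C2 \<Longrightarrow> norm (X y - x1) \<le> k1 * norm (y - y1)"
    using split_step_contraction[OF c Q1 Q2 assms(15,16,19,20,23-25) B m \<theta>(1,3) p(1,3) lt(1)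
        mem(2) mem(4)[unfolded y2_def] fp(1) fp(2)[unfolded x2_def y2_def]]
    unfolding X_def by blast
  obtain k2 where k2: "k2 < 1"
    "\<And>x. x \<in> C1 \<Longrightarrow> blinfun_apply A x \<in> C2 \<Longrightarrow> norm (Y x - y1) \<le> k2 * norm (x - x1)"
    using split_step_contraction[OF c Q1 Q2 assms(17,18,21,22,23-25) B m \<theta>(2,4) p(2,4) lt(2)
        mem(1) mem(3)[unfolded x2_def] fp(3) fp(4)[unfolded x2_def y2_def]]
    unfolding Y_def by blast
  define k where "k = max k1 k2"
  \<comment> \<open>Each update error is controlled by the error of the other sequence, so only the
    sum of both is compared with itself.\<close>
  define S where "S n = norm (xs n - x1) + norm (ys n - y1)" for n
  have it: "xs n \<in> C1" "ys n \<in> C1" "blinfun_apply A (xs n) \<in> C2" "blinfun_apply A (ys n) \<in> C2"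
    "xs (Suc n) = (1 - a n) *\<^sub>R xs n + a n *\<^sub>R X (ys n)"
    "ys (Suc n) = (1 - a n) *\<^sub>R ys n + a n *\<^sub>R Y (xs n)" for n
    using gen unfolding generated_by_algorithm_def Let_def X_def Y_def B_def by blast+
  have relax: "norm ((1 - t) *\<^sub>R u + t *\<^sub>R v - w) \<le> (1 - t) * norm (u - w) + t * norm (v - w)"
    if "0 < t" "t < 1" for t and u v w :: 'a
  proof -
    have "(1 - t) *\<^sub>R u + t *\<^sub>R v - w = (1 - t) *\<^sub>R (u - w) + t *\<^sub>R (v - w)"
      by (simp add: algebra_simps)
    then show ?thesis
      using norm_triangle_ineq[of "(1 - t) *\<^sub>R (u - w)" "t *\<^sub>R (v - w)"] that by simp
  qed
  have "S \<longlonglongrightarrow> 0"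
  proof (rule relaxed_contraction_tendsto_0[OF _ _ _ assms(36)])
    show "0 < 1 - k" using k1 k2 by (simp add: k_def)
    show "0 \<le> S n" for n by (simp add: S_def)
    show "S (Suc n) \<le> (1 - a n * (1 - k)) * S n" for n
    proof -
      have an: "0 < a n" "a n < 1" using assms(35) by auto
      have "norm (X (ys n) - x1) \<le> k1 * norm (ys n - y1)" "norm (Y (xs n) - y1) \<le> k2 * norm (xs n - x1)"
        using k1 k2 it by auto
      moreover have "k1 * norm (ys n - y1) \<le> k * norm (ys n - y1)"
        "k2 * norm (xs n - x1) \<le> k * norm (xs n - x1)"
        by (auto simp: k_def intro!: mult_right_mono)
      ultimately have "norm (X (ys n) - x1) + norm (Y (xs n) - y1) \<le> k * S n"
        by (simp add: S_def algebra_simps)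
      then have "a n * (norm (X (ys n) - x1) + norm (Y (xs n) - y1)) \<le> a n * (k * S n)"
        using an by (intro mult_left_mono) auto
      \<comment> \<open>Relaxation weights the old error by \<open>1 - a n\<close> and the update
        error by \<open>a n\<close>; as the latter is at most \<open>k * S n\<close>, the total
        factor is \<open>1 - a n * (1 - k)\<close>.\<close>
      moreover have "S (Suc n) \<le> (1 - a n) * S n
          + a n * (norm (X (ys n) - x1) + norm (Y (xs n) - y1))"
        using relax[OF an, of "xs n" "X (ys n)" x1, folded it(5)]
          relax[OF an, of "ys n" "Y (xs n)" y1, folded it(6)]
        by (simp add: S_def algebra_simps)
      ultimately show ?thesis by (simp add: algebra_simps)
    qed
  qed
  then have "(\<lambda>n. xs n - x1) \<longlonglongrightarrow> 0" "(\<lambda>n. ys n - y1) \<longlonglongrightarrow> 0"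
    by (auto intro!: Lim_null_comparison[of _ S] simp: S_def)
  then show ?thesis
    by (intro tendsto_Pair) (simp_all add: LIM_zero_iff)
qed

end
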